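(* (5-degree modular equation of Ramanujan's cubic continued fraction.) Let $q\in(0,1)$ and put $u=V(q)$ and $v=V(q^{5})$. Then $$u^6-uv+5u^4v+5u^2v^2-10u^5v^2-20u^3v^3+5uv^4+20u^4v^4-10u^2v^5-16u^5v^5+v^6=0.$$
   Context: For $0<q<1$, $V(q)=R(1,3,6;q)$ denotes Ramanujan's cubic continued fraction, $$V(q)=q^{1/3}\prod_{n=0}^{\infty}\frac{(1-q^{6n+1})(1-q^{6n+5})}{(1-q^{6n+3})^{2}}.$$ *)

theory Defs
  imports "HOL-Analysis.Analysis"
begin

text \<open>Ramanujan's cubic continued fraction through its product expansion; meaningful for 0 < q < 1, where the product converges.\<close>

definition cubic_cf :: "real \<Rightarrow> real" where
  "cubic_cf q = q powr (1/3) *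
     (\<Prod>n. (1 - q ^ (6*n+1)) * (1 - q ^ (6*n+5)) / (1 - q ^ (6*n+3))\<^sup>2)"

end

theory Submission
  imports Defs
begin

text \<open>
  Write \<open>e\<^sub>d = (q\<^sup>d; q\<^sup>d)\<^sub>\<infinity>\<close>. Three Weierstrass three-term relations, in bases \<open>q\<^sup>6\<close>, \<open>q\<^sup>1\<^sup>0\<close> and
  \<open>q\<^sup>3\<^sup>0\<close>, show that for the eta quotients \<open>x = u\<^sup>3\<close>,
  \<open>c = q e\<^sub>1\<^sup>2 e\<^sub>1\<^sub>0\<^sup>4 / (e\<^sub>2\<^sup>4 e\<^sub>5\<^sup>2)\<close> and
  \<open>t = q e\<^sub>2\<^sup>2 e\<^sub>3 e\<^sub>5 e\<^sub>3\<^sub>0\<^sup>2 / (e\<^sub>1 e\<^sub>6\<^sup>2 e\<^sub>1\<^sub>0\<^sup>2 e\<^sub>1\<^sub>5)\<close> also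
  \<open>1 + x\<close>, \<open>1 - c\<close> and \<open>1 + t\<close> are eta quotients. Moreover \<open>c(q\<^sup>3) = t\<^sup>2 c\<close>, so comparing exponents makes
  \<open>u v\<close>, \<open>u\<^sup>3\<close> and \<open>v\<^sup>3\<close> rational functions of \<open>t\<close> and \<open>c\<close>, while the relation for
  \<open>(1 + v\<^sup>3) / (1 + u\<^sup>3)\<close> gives an equation between \<open>t\<close> and \<open>c\<close> (a model of \<open>X\<^sub>0(30)\<close>). The modular equation
  depends only on \<open>u v\<close> and \<open>u\<^sup>3 + v\<^sup>3\<close> and is a multiple of that equation.

  The Weierstrass relation is a Pluecker relation: by the Jacobi triple product,
  \<open>\<theta>(x y) \<theta>(x / y) / x\<close> is a \<open>2 \<times> 2\<close> determinant in functions of \<open>x\<close> and of \<open>y\<close>.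
\<close>

section \<open>Infinite q-products\<close>

definition qpoch :: "real \<Rightarrow> real \<Rightarrow> real" where
  "qpoch a p = (\<Prod>n. 1 - a * p ^ n)"

text \<open>The modified Jacobi theta function of base \<open>p\<close>: the factor
  \<open>qpoch p p\<close> of the triple product is left out and carried separately.\<close>

definition qtheta :: "real \<Rightarrow> real \<Rightarrow> real" where
  "qtheta p x = qpoch x p * qpoch (p / x) p"

lemma convergent_prod_qpoch:
  fixes a p :: real
  assumes "\<bar>p\<bar> < 1"
  shows "convergent_prod (\<lambda>n. 1 - a * p ^ n)"
proof -
  have "summable (\<lambda>n. \<bar>- a * p ^ n\<bar>)"
    using assms by (auto simp: abs_mult power_abs intro!: summable_mult summable_geometric)
  hence "summable (\<lambda>n. norm ((1 - a * p ^ n) - 1))" by simp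
  thus ?thesis
    by (intro abs_convergent_prod_imp_convergent_prod summable_imp_abs_convergent_prod)
qed

lemma qpoch_LIMSEQ:
  assumes "\<bar>p\<bar> < 1"
  shows "(\<lambda>N. \<Prod>n<N. 1 - a * p ^ n) \<longlonglongrightarrow> qpoch a p"
proof -
  have "(\<lambda>N. \<Prod>n\<le>N. 1 - a * p ^ n) \<longlonglongrightarrow> qpoch a p"
    unfolding qpoch_def by (rule convergent_prod_LIMSEQ[OF convergent_prod_qpoch[OF assms]])
  thus ?thesis
    by (subst filterlim_sequentially_Suc[symmetric]) (simp add: lessThan_Suc_atMost)
qed

lemma qpoch_pos:
  assumes "0 \<le> p" "p < 1" "a < 1"
  shows "qpoch a p > 0"
proof -
  have "0 < 1 - a * p ^ n" for n
  proof -
    have pn: "0 \<le> p ^ n" "p ^ n \<le> 1" using assms by (auto simp: power_le_one)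
    show ?thesis
    proof (cases "a \<ge> 0")
      case True
      have "a * p ^ n \<le> a * 1" using pn True by (intro mult_left_mono) auto
      thus ?thesis using assms by simp
    next
      case False
      hence "a * p ^ n \<le> 0" using pn by (simp add: mult_nonpos_nonneg)
      thus ?thesis by simp
    qed
  qed
  thus ?thesis unfolding qpoch_def
    using convergent_prod_qpoch[of p a] assms by (intro less_0_prodinf) auto
qed

text \<open>Sorting the indices by their residue modulo \<open>m\<close> turns the partial product
  of length \<open>m * N\<close> into \<open>m\<close> partial products of length \<open>N\<close>
  in the base \<open>p ^ m\<close>; the limit is then taken along the subsequence
  \<open>m * N\<close>.\<close>

lemma qpoch_multisection:
  assumes "\<bar>p\<bar> < 1" "m > 0"
  shows "qpoch a p = (\<Prod>j<m. qpoch (a * p ^ j) (p ^ m))"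
proof -
  have pm: "\<bar>p ^ m\<bar> < 1" using assms by (simp add: power_abs power_less_one_iff)
  have eq: "(\<Prod>n<m * N. 1 - a * p ^ n) = (\<Prod>j<m. \<Prod>n<N. 1 - a * p ^ j * (p ^ m) ^ n)" for N
  proof -
    have "(\<Prod>n<m * N. 1 - a * p ^ n) = (\<Prod>n<N. \<Prod>j<m. 1 - a * p ^ (j + n * m))"
      using prod.nat_group[of "\<lambda>n. 1 - a * p ^ n" m N]
      by (simp add: prod.atLeastLessThan_shift_0[of _ "_ * m"] lessThan_atLeast0 o_def
            add.commute[of "_ * m"] mult.commute[of m N])
    also have "\<dots> = (\<Prod>j<m. \<Prod>n<N. 1 - a * p ^ (j + n * m))" by (rule prod.swap)
    finally show ?thesis by (simp add: power_add mult_ac flip: power_mult)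
  qed
  have "filterlim (\<lambda>N. m * N) sequentially sequentially"
    using assms(2) by (intro filterlim_subseq strict_monoI) auto
  with qpoch_LIMSEQ[OF assms(1)]
  have "(\<lambda>N. \<Prod>n<m * N. 1 - a * p ^ n) \<longlonglongrightarrow> qpoch a p"
    by (rule filterlim_compose)
  moreover have "(\<lambda>N. \<Prod>n<m * N. 1 - a * p ^ n) \<longlonglongrightarrow> (\<Prod>j<m. qpoch (a * p ^ j) (p ^ m))"
    unfolding eq by (intro tendsto_prod qpoch_LIMSEQ pm)
  ultimately show ?thesis by (rule LIMSEQ_unique)
qed

section \<open>The Jacobi triple product\<close>

text \<open>The ratio of consecutive terms is \<open>p * z * p ^ (2 * n)\<close>, which tends to 0
  however large \<open>z\<close> is.\<close>

lemma summable_theta_nat: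
  fixes p z :: real
  assumes "0 < p" "p < 1" "0 < z"
  shows "summable (\<lambda>n. p ^ (n * n) * z ^ n)"
proof -
  have "(\<lambda>n. (p * z) * (p\<^sup>2) ^ n) \<longlonglongrightarrow> (p * z) * 0"
    using assms by (intro tendsto_intros LIMSEQ_realpow_zero) (auto simp: power_less_one_iff)
  hence "eventually (\<lambda>n. (p * z) * (p\<^sup>2) ^ n < 1 / 2) sequentially"
    by (rule order_tendstoD) simp
  then obtain N where N: "\<And>n. n \<ge> N \<Longrightarrow> (p * z) * (p\<^sup>2) ^ n < 1 / 2"
    by (auto simp: eventually_sequentially)
  show ?thesis
  proof (rule summable_ratio_test[of "1/2" N])
    fix n assume "n \<ge> N"
    have "p ^ (Suc n * Suc n) * z ^ Suc n = ((p * z) * (p\<^sup>2) ^ n) * (p ^ (n * n) * z ^ n)"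
      by (simp add: power_add power_mult_distrib power_mult [symmetric] algebra_simps power2_eq_square)
    also have "\<dots> \<le> 1 / 2 * (p ^ (n * n) * z ^ n)"
      using assms N[OF \<open>n \<ge> N\<close>] by (intro mult_right_mono) auto
    finally show "norm (p ^ (Suc n * Suc n) * z ^ Suc n) \<le> 1 / 2 * norm (p ^ (n * n) * z ^ n)"
      using assms by simp
  qed simp
qed

text \<open>The general term of the triple product is taken with nome \<open>p\<close>, i.e. for the base \<open>p\<^sup>2\<close>, so that the
  exponent \<open>n\<^sup>2\<close> needs no halving.\<close>

definition theta_term :: "real \<Rightarrow> real \<Rightarrow> int \<Rightarrow> real" where
  "theta_term p z n = p powi (n * n) * z powi n"

lemma theta_term_int: "theta_term p z (int n) = p ^ (n * n) * z ^ n"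
  unfolding theta_term_def of_nat_mult[symmetric] power_int_of_nat ..

lemma theta_term_uminus: "theta_term p z (- n) = theta_term p (inverse z) n"
  by (simp add: theta_term_def power_int_minus power_int_inverse)

lemma norm_theta_term: "p \<ge> 0 \<Longrightarrow> norm (theta_term p z n) = theta_term p \<bar>z\<bar> n"
  by (simp add: theta_term_def abs_mult power_int_abs)

lemma summable_on_theta_term_pos:
  assumes "0 < p" "p < 1" "0 < z"
  shows "theta_term p z summable_on UNIV"
proof -
  have range: "theta_term p w summable_on range int" if "0 < w" for w
  proof -
    have "(\<lambda>n. theta_term p w (int n)) summable_on UNIV"
      unfolding theta_term_int using summable_theta_nat[OF assms(1,2) that] assms that
      by (subst summable_on_UNIV_nonneg_real_iff) auto
    thus ?thesis by (subst summable_on_reindex) (auto simp: o_def)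
  qed
  have "theta_term p (inverse z) summable_on range int"
    using assms by (intro range) auto
  hence "theta_term p z summable_on uminus ` range int"
    by (subst summable_on_reindex) (auto simp: o_def theta_term_uminus)
  \<comment> \<open>Both half-lines contain 0; removing \<open>range int\<close> leaves the negative
    integers and makes the union disjoint.\<close>
  hence "theta_term p z summable_on (uminus ` range int - range int)"
    by (rule summable_on_subset_banach) auto
  with range[OF assms(3)] have "theta_term p z summable_on (range int \<union> (uminus ` range int - range int))"
    by (intro summable_on_Un_disjoint) auto
  also have "range int \<union> (uminus ` range int - range int) = UNIV"
    by (auto simp: image_iff) (metis int_cases2)
  finally show ?thesis .
qed

lemma abs_summable_on_theta_term:
  assumes "0 < p" "p < 1" "z \<noteq> 0"
  shows "(\<lambda>n. norm (theta_term p z n)) summable_on UNIV"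
  using summable_on_theta_term_pos[of p "\<bar>z\<bar>"] assms by (simp add: norm_theta_term del: real_norm_def)


text \<open>Dominated convergence for unordered sums. The bound \<open>M\<close> makes the finite
  partial sums converge uniformly in \<open>N\<close>, so the limit in \<open>N\<close> and the
  limit over finite subsets may be exchanged.\<close>

lemma has_sum_dominated_convergence:
  fixes f :: "nat \<Rightarrow> 'a \<Rightarrow> 'b :: banach"
  assumes sum: "\<And>N. (f N has_sum S N) A"
    and bound: "\<And>N x. x \<in> A \<Longrightarrow> norm (f N x) \<le> M x" and "M summable_on A"
    and lim: "\<And>x. x \<in> A \<Longrightarrow> (\<lambda>N. f N x) \<longlonglongrightarrow> g x" and S: "S \<longlonglongrightarrow> l"
  shows "(g has_sum l) A"
proof -
  have "norm (g x) \<le> M x" if "x \<in> A" for x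
    using tendsto_norm[OF lim[OF that]] bound[OF that] by (intro LIMSEQ_le_const2) auto
  hence "(\<lambda>x. norm (g x)) summable_on A"
    by (intro summable_on_comparison_test[OF assms(3)]) auto
  hence "g summable_on A" by (rule abs_summable_summable)
  hence g: "(g has_sum infsum g A) A" by (rule has_sum_infsum)
  have "S \<longlonglongrightarrow> infsum g A"
  proof (rule swap_uniform_limit')
    show "uniform_limit UNIV (\<lambda>X N. \<Sum>x\<in>X. f N x) S (finite_subsets_at_top A)"
      using bound sum assms(3) by (intro Weierstrass_m_test_general') auto
    show "\<forall>\<^sub>F X in finite_subsets_at_top A. (\<lambda>N. \<Sum>x\<in>X. f N x) \<longlonglongrightarrow> (\<Sum>x\<in>X. g x)"
      using lim by (intro eventually_finite_subsets_at_top_weakI tendsto_sum) auto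
    show "((\<lambda>X. \<Sum>x\<in>X. g x) \<longlongrightarrow> infsum g A) (finite_subsets_at_top A)"
      using g by (simp add: has_sum_def)
  qed auto
  with S have "l = infsum g A" by (rule LIMSEQ_unique)
  with g show ?thesis by simp
qed

section \<open>Finite q-factorials and Gaussian binomials\<close>

definition qfact :: "real \<Rightarrow> nat \<Rightarrow> real" where
  "qfact p n = (\<Prod>k<n. 1 - p ^ Suc k)"

text \<open>Extending \<open>1 / (p; p)\<^sub>k\<close> by 0 to negative \<open>k\<close> makes its recurrence, hence also that of the central
  binomials, valid for all integers.\<close>

definition inv_qfact :: "real \<Rightarrow> int \<Rightarrow> real" where
  "inv_qfact p k = (if k < 0 then 0 else 1 / qfact p (nat k))"

text \<open>The Gaussian binomial coefficient "2N choose N + n" in base \<open>p\<close>, which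
  vanishes for |n| > N.\<close>

definition central_qbinomial :: "real \<Rightarrow> nat \<Rightarrow> int \<Rightarrow> real" where
  "central_qbinomial p N n = qfact p (2 * N) * inv_qfact p (int N - n) * inv_qfact p (int N + n)"

context
  fixes p :: real
  assumes p: "0 < p" "p < 1"
begin

lemma qfact_factor: "0 < 1 - p ^ Suc k" "1 - p ^ Suc k \<le> 1"
  using p power_Suc_less_one[of p k] by auto

lemma qfact_pos: "qfact p n > 0"
  unfolding qfact_def using qfact_factor by (intro prod_pos) auto

lemma qfact_le_1: "qfact p n \<le> 1"
  unfolding qfact_def using qfact_factor by (intro prod_le_1) (auto intro: less_imp_le)

lemma qfact_LIMSEQ: "qfact p \<longlonglongrightarrow> qpoch p p"
  using qpoch_LIMSEQ[of p p] p by (simp add: qfact_def[abs_def])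

lemma qpoch_self_pos: "qpoch p p > 0"
  using p by (intro qpoch_pos) auto

lemma qpoch_le_qfact: "qpoch p p \<le> qfact p n"
proof -
  have "decseq (qfact p)"
  proof (rule decseq_SucI)
    fix n
    have "qfact p n * (1 - p ^ Suc n) \<le> qfact p n * 1"
      using qfact_factor qfact_pos[of n] by (intro mult_left_mono) auto
    thus "qfact p (Suc n) \<le> qfact p n" by (simp add: qfact_def)
  qed
  thus ?thesis using qfact_LIMSEQ by (rule decseq_ge)
qed

lemma inv_qfact_minus_1: "inv_qfact p (k - 1) = (1 - p powi k) * inv_qfact p k"
proof (cases "k > 0")
  case True
  then obtain m where m: "k = int (Suc m)"
    using zero_less_imp_eq_int by (metis Suc_pred)
  have "1 - p ^ Suc m \<noteq> 0" using qfact_factor[of m] by simp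
  moreover have "nat (1 + int m) = Suc m" by simp
  ultimately show ?thesis using qfact_pos[of m]
    unfolding m power_int_of_nat by (simp add: inv_qfact_def qfact_def del: power_Suc)
\<comment> \<open>At \<open>k = 0\<close> the factor \<open>1 - p powi 0\<close> vanishes, in
  agreement with the value 0 at -1.\<close>
qed (auto simp: inv_qfact_def)

lemma inv_qfact_bounds: "0 \<le> inv_qfact p k" "inv_qfact p k \<le> 1 / qpoch p p"
  using qfact_pos[of "nat k"] qpoch_self_pos qpoch_le_qfact[of "nat k"]
  by (auto simp: inv_qfact_def intro!: divide_left_mono)

lemma inv_qfact_LIMSEQ:
  "(\<lambda>N. inv_qfact p (int N + n)) \<longlonglongrightarrow> 1 / qpoch p p"
proof -
  have *: "(\<lambda>N. 1 / qfact p N) \<longlonglongrightarrow> 1 / qpoch p p"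
    using qfact_LIMSEQ qpoch_self_pos by (intro tendsto_intros) auto
  have "filterlim (\<lambda>N. nat (int N + n)) at_top sequentially"
    unfolding filterlim_at_top
  proof
    fix Z :: nat
    show "eventually (\<lambda>N. Z \<le> nat (int N + n)) sequentially"
      by (rule eventually_sequentiallyI[of "Z + nat (- n)"]) auto
  qed
  from filterlim_compose[OF * this]
  have "(\<lambda>N. 1 / qfact p (nat (int N + n))) \<longlonglongrightarrow> 1 / qpoch p p" .
  moreover have "eventually (\<lambda>N. 1 / qfact p (nat (int N + n)) = inv_qfact p (int N + n)) sequentially"
    by (rule eventually_sequentiallyI[of "nat (- n)"]) (auto simp: inv_qfact_def)
  ultimately show ?thesis by (rule Lim_transform_eventually)
qed

text \<open>The upper bound depends on neither \<open>N\<close> nor \<open>n\<close>, so it supplies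
  the dominating series when \<open>N\<close> tends to infinity.\<close>

lemma central_qbinomial_bounds:
  "0 \<le> central_qbinomial p N n" "central_qbinomial p N n \<le> 1 / (qpoch p p)\<^sup>2"
proof -
  show "0 \<le> central_qbinomial p N n"
    using qfact_pos[of "2 * N"] inv_qfact_bounds(1) by (simp add: central_qbinomial_def)
  have "central_qbinomial p N n \<le> 1 * (1 / qpoch p p) * (1 / qpoch p p)"
    unfolding central_qbinomial_def using qfact_pos[of "2 * N"] qpoch_self_pos
    by (intro mult_mono inv_qfact_bounds qfact_le_1) (auto simp: inv_qfact_bounds)
  thus "central_qbinomial p N n \<le> 1 / (qpoch p p)\<^sup>2"
    by (simp add: power2_eq_square)
qed

lemma central_qbinomial_LIMSEQ: "(\<lambda>N. central_qbinomial p N n) \<longlonglongrightarrow> 1 / qpoch p p"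
proof -
  have "filterlim (\<lambda>N. 2 * N) sequentially sequentially"
    by (intro filterlim_subseq strict_monoI) auto
  from filterlim_compose[OF qfact_LIMSEQ this]
  have "(\<lambda>N. central_qbinomial p N n) \<longlonglongrightarrow> qpoch p p * (1 / qpoch p p) * (1 / qpoch p p)"
    unfolding central_qbinomial_def
    using inv_qfact_LIMSEQ[of n] inv_qfact_LIMSEQ[of "- n"] by (intro tendsto_mult) auto
  thus ?thesis using qpoch_self_pos by simp
qed

lemma central_qbinomial_0: "central_qbinomial p 0 n = (if n = 0 then 1 else 0)"
  by (auto simp: central_qbinomial_def inv_qfact_def qfact_def)

text \<open>Two q-Pascal steps in one: this is the coefficient recurrence caused by adjoining one
  pair of factors to the finite triple product. With A = p^(N-n) and B = p^(N+n), so that A B =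
  p^(2N), every term is a polynomial in \<open>p\<close>, \<open>A\<close>, \<open>B\<close> times a
  common factor.\<close>

lemma central_qbinomial_Suc:
  "central_qbinomial p (Suc N) n =
     (1 + p ^ (2 * N + 1)) * central_qbinomial p N n +
     p powi (int N + 1 - n) * central_qbinomial p N (n - 1) +
     p powi (int N + 1 + n) * central_qbinomial p N (n + 1)"
proof -
  define a b where "a = int N - n" and "b = int N + n"
  define A B where "A = p powi a" and "B = p powi b"
  define X Y where "X = inv_qfact p (a + 1)" and "Y = inv_qfact p (b + 1)"
  have pA: "p powi (a + 1) = p * A" "p powi (b + 1) = p * B"
    using p by (simp_all add: A_def B_def power_int_add_1')
  have AB: "A * B = p ^ (2 * N)"
  proof -
    have "A * B = p powi (a + b)" using p by (simp add: A_def B_def power_int_add)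
    also have "a + b = int (2 * N)" by (simp add: a_def b_def)
    finally show ?thesis unfolding power_int_of_nat .
  qed
  have X: "inv_qfact p a = (1 - p * A) * X" "inv_qfact p b = (1 - p * B) * Y"
    using inv_qfact_minus_1[of "a + 1"] inv_qfact_minus_1[of "b + 1"]
    by (simp_all add: X_def Y_def pA)
  have X': "inv_qfact p (a - 1) = (1 - A) * (1 - p * A) * X"
    "inv_qfact p (b - 1) = (1 - B) * (1 - p * B) * Y"
    using inv_qfact_minus_1[of a] inv_qfact_minus_1[of b] by (simp_all add: X A_def B_def)
  have F: "qfact p (2 * Suc N) = qfact p (2 * N) * (1 - p * (A * B)) * (1 - p * p * (A * B))"
    unfolding AB by (simp add: qfact_def mult_ac)
  have L: "central_qbinomial p (Suc N) n = qfact p (2 * Suc N) * X * Y"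
    by (simp add: central_qbinomial_def X_def Y_def a_def b_def algebra_simps)
  have R1: "central_qbinomial p N n = qfact p (2 * N) * inv_qfact p a * inv_qfact p b"
    by (simp add: central_qbinomial_def a_def b_def)
  have R2: "central_qbinomial p N (n - 1) = qfact p (2 * N) * X * inv_qfact p (b - 1)"
    by (simp add: central_qbinomial_def X_def a_def b_def algebra_simps)
  have R3: "central_qbinomial p N (n + 1) = qfact p (2 * N) * inv_qfact p (a - 1) * Y"
    by (simp add: central_qbinomial_def Y_def a_def b_def algebra_simps)
  have e: "int N + 1 - n = a + 1" "int N + 1 + n = b + 1"
    by (simp_all add: a_def b_def)
  have P: "p ^ (2 * N + 1) = p * (A * B)" unfolding AB by simp
  show ?thesis
    unfolding L R1 R2 R3 e pA F X X' P by algebra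
qed

end

section \<open>The finite triple product and its limit\<close>

lemma theta_term_shift:
  assumes "r \<noteq> 0" "z \<noteq> 0"
  shows "z * theta_term r z (n - 1) = r powi (1 - 2 * n) * theta_term r z n"
    and "inverse z * theta_term r z (n + 1) = r powi (1 + 2 * n) * theta_term r z n"
proof -
  have "(n - 1) * (n - 1) = (1 - 2 * n) + n * n" "(n + 1) * (n + 1) = (1 + 2 * n) + n * n"
    by (simp_all add: algebra_simps)
  thus "z * theta_term r z (n - 1) = r powi (1 - 2 * n) * theta_term r z n"
    and "inverse z * theta_term r z (n + 1) = r powi (1 + 2 * n) * theta_term r z n"
    unfolding theta_term_def using assms
    by (simp_all only: power_int_add) (simp_all add: power_int_diff power_int_add)
qed

text \<open>Induction on \<open>N\<close>. The new pair of factors expands to 1 + r^(4N+2) +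
  r^(2N+1) (z + 1/z), so it combines the series with its two shifts by one index; the powers of
  \<open>r\<close> left by the shifts are those of \<open>central_qbinomial_Suc\<close> in base
  \<open>r\<^sup>2\<close>. Summing over all integers keeps the index set independent of
  \<open>N\<close>.\<close>

lemma finite_jacobi_triple_product:
  assumes r: "0 < r" "r < 1" and z: "z \<noteq> 0"
  shows "((\<lambda>n. theta_term r z n * central_qbinomial (r\<^sup>2) N n) has_sum
           (\<Prod>k<N. (1 + z * r ^ (2 * k + 1)) * (1 + r ^ (2 * k + 1) / z))) UNIV"
proof (induction N)
  case 0
  have p: "0 < r\<^sup>2" "r\<^sup>2 < 1" using r by (auto simp: power_less_one_iff)
  show ?case
    unfolding central_qbinomial_0[OF p]
    by (rule has_sum_finite_neutralI[of "{0}"]) (auto simp: theta_term_def)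
next
  case (Suc N)
  have p: "0 < r\<^sup>2" "r\<^sup>2 < 1" using r by (auto simp: power_less_one_iff)
  define f where "f = (\<lambda>n. theta_term r z n * central_qbinomial (r\<^sup>2) N n)"
  define P where "P = (\<Prod>k<N. (1 + z * r ^ (2 * k + 1)) * (1 + r ^ (2 * k + 1) / z))"
  have f: "(f has_sum P) UNIV" using Suc by (simp add: f_def P_def)
  have bij: "bij (\<lambda>n. n - (1::int))" "bij (\<lambda>n. n + (1::int))"
    by (auto intro!: bijI' simp: algebra_simps) presburger+
  have f1: "((\<lambda>n. f (n - 1)) has_sum P) UNIV" "((\<lambda>n. f (n + 1)) has_sum P) UNIV"
    using f has_sum_reindex_bij_betw[OF bij(1), of f P] has_sum_reindex_bij_betw[OF bij(2), of f P]
    by auto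
  have "((\<lambda>n. (1 + r ^ (4 * N + 2)) * f n + r ^ (2 * N + 1) * z * f (n - 1) +
            r ^ (2 * N + 1) * inverse z * f (n + 1)) has_sum
         ((1 + r ^ (4 * N + 2)) * P + r ^ (2 * N + 1) * z * P + r ^ (2 * N + 1) * inverse z * P)) UNIV"
    by (intro has_sum_add has_sum_cmult_right f f1)
  also have "(1 + r ^ (4 * N + 2)) * P + r ^ (2 * N + 1) * z * P + r ^ (2 * N + 1) * inverse z * P =
               P * ((1 + z * r ^ (2 * N + 1)) * (1 + r ^ (2 * N + 1) / z))"
  proof -
    have "r ^ (4 * N + 2) = r ^ (2 * N + 1) * r ^ (2 * N + 1)"
      unfolding power_add[symmetric] by simp
    thus ?thesis using z by (simp add: field_simps)
  qed
  also have "(\<lambda>n. (1 + r ^ (4 * N + 2)) * f n + r ^ (2 * N + 1) * z * f (n - 1) +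
            r ^ (2 * N + 1) * inverse z * f (n + 1)) =
             (\<lambda>n. theta_term r z n * central_qbinomial (r\<^sup>2) (Suc N) n)"
  proof
    fix n :: int
    have r2: "r\<^sup>2 powi k = r powi (2 * k)" for k
      by (simp add: power_int_mult)
    have e: "r ^ (2 * N + 1) * r powi (1 + 2 * k) = r\<^sup>2 powi (int N + 1 + k)" for k
    proof -
      have "r ^ (2 * N + 1) * r powi (1 + 2 * k) = r powi (int (2 * N + 1) + (1 + 2 * k))"
        by (subst power_int_add) (use r in \<open>auto simp only: power_int_of_nat\<close>)
      also have "int (2 * N + 1) + (1 + 2 * k) = 2 * (int N + 1 + k)" by simp
      finally show ?thesis by (simp only: r2)
    qed
    have e: "r ^ (2 * N + 1) * r powi (1 - 2 * n) = r\<^sup>2 powi (int N + 1 - n)"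
      "r ^ (2 * N + 1) * r powi (1 + 2 * n) = r\<^sup>2 powi (int N + 1 + n)"
      using e[of "- n"] e[of n] by simp_all
    have "4 * N + 2 = 2 * (2 * N + 1)" by simp
    hence e4: "r ^ (4 * N + 2) = r\<^sup>2 ^ (2 * N + 1)" by (simp only: power_mult)
    have "(1 + r ^ (4 * N + 2)) * f n + r ^ (2 * N + 1) * z * f (n - 1) +
            r ^ (2 * N + 1) * inverse z * f (n + 1) =
          (1 + r\<^sup>2 ^ (2 * N + 1)) * theta_term r z n * central_qbinomial (r\<^sup>2) N n +
          r ^ (2 * N + 1) * (z * theta_term r z (n - 1)) * central_qbinomial (r\<^sup>2) N (n - 1) +
          r ^ (2 * N + 1) * (inverse z * theta_term r z (n + 1)) * central_qbinomial (r\<^sup>2) N (n + 1)"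
      unfolding f_def e4 by (simp only: mult.assoc)
    also have "\<dots> = theta_term r z n * central_qbinomial (r\<^sup>2) (Suc N) n"
      unfolding central_qbinomial_Suc[OF p] e[symmetric] theta_term_shift[OF _ z, of r n, OF less_imp_neq[OF r(1), symmetric]]
      by algebra
    finally show "(1 + r ^ (4 * N + 2)) * f n + r ^ (2 * N + 1) * z * f (n - 1) +
            r ^ (2 * N + 1) * inverse z * f (n + 1) =
          theta_term r z n * central_qbinomial (r\<^sup>2) (Suc N) n" .
  qed
  finally show ?case by (simp only: P_def prod.lessThan_Suc)
qed

text \<open>Limit of the finite form: each central binomial tends to \<open>1 / qpoch p p\<close>
  with p = r^2 and is bounded by \<open>1 / (qpoch p p)\<^sup>2\<close>, so dominated convergence
  applies.\<close>

theorem jacobi_triple_product: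
  assumes r: "0 < r" "r < 1" and z: "z \<noteq> 0"
  shows "(theta_term r z has_sum
           (qpoch (- z * r) (r\<^sup>2) * qpoch (- r / z) (r\<^sup>2) * qpoch (r\<^sup>2) (r\<^sup>2))) UNIV"
proof -
  define p where "p = r\<^sup>2"
  have p: "0 < p" "p < 1" using r by (auto simp: p_def power_less_one_iff)
  have "((\<lambda>n. theta_term r z n * (1 / qpoch p p)) has_sum
          (qpoch (- z * r) p * qpoch (- r / z) p)) UNIV"
  proof (rule has_sum_dominated_convergence)
    show "((\<lambda>n. theta_term r z n * central_qbinomial p N n) has_sum
           (\<Prod>k<N. (1 + z * r ^ (2 * k + 1)) * (1 + r ^ (2 * k + 1) / z))) UNIV" for N
      unfolding p_def by (rule finite_jacobi_triple_product[OF assms])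
    show "(\<lambda>n. norm (theta_term r z n) * (1 / (qpoch p p)\<^sup>2)) summable_on UNIV"
      by (intro summable_on_cmult_left abs_summable_on_theta_term assms)
    show "norm (theta_term r z n * central_qbinomial p N n) \<le>
            norm (theta_term r z n) * (1 / (qpoch p p)\<^sup>2)" for n N
      using central_qbinomial_bounds[OF p, of N n]
      unfolding norm_mult by (intro mult_left_mono) auto
    show "(\<lambda>N. theta_term r z n * central_qbinomial p N n) \<longlonglongrightarrow> theta_term r z n * (1 / qpoch p p)" for n
      by (intro tendsto_intros central_qbinomial_LIMSEQ p)
    have "(\<lambda>N. (\<Prod>k<N. 1 - (- z * r) * p ^ k) * (\<Prod>k<N. 1 - (- r / z) * p ^ k)) \<longlonglongrightarrow>
            qpoch (- z * r) p * qpoch (- r / z) p"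
      using p by (intro tendsto_mult qpoch_LIMSEQ) auto
    thus "(\<lambda>N. \<Prod>k<N. (1 + z * r ^ (2 * k + 1)) * (1 + r ^ (2 * k + 1) / z)) \<longlonglongrightarrow>
            qpoch (- z * r) p * qpoch (- r / z) p"
      by (simp add: p_def prod.distrib power_add mult_ac flip: power_mult)
  qed
  from has_sum_cmult_left[OF this, of "qpoch p p"] show ?thesis
    using qpoch_self_pos[OF p] by (simp add: p_def)
qed


section \<open>The Weierstrass relation\<close>

lemma has_sum_product:
  fixes f :: "'a \<Rightarrow> real" and g :: "'b \<Rightarrow> real"
  assumes f: "(\<lambda>x. norm (f x)) summable_on UNIV" "(f has_sum a) UNIV"
    and g: "(\<lambda>x. norm (g x)) summable_on UNIV" "(g has_sum b) UNIV"
  shows "((\<lambda>(x, y). f x * g y) has_sum (a * b)) UNIV"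
proof -
  have "(\<lambda>(x, y). f x * g y) summable_on (UNIV \<times> UNIV)"
  proof (rule abs_summable_summable, rule summable_on_SigmaI)
    show "((\<lambda>y. norm (case (x, y) of (x, y) \<Rightarrow> f x * g y)) has_sum
            norm (f x) * (\<Sum>\<^sub>\<infinity>y. norm (g y))) UNIV" for x
      unfolding prod.case norm_mult by (intro has_sum_cmult_right has_sum_infsum g)
    show "(\<lambda>x. norm (f x) * (\<Sum>\<^sub>\<infinity>y. norm (g y))) summable_on UNIV"
      by (intro summable_on_cmult_left f)
  qed auto
  moreover have "((\<lambda>y. f x * g y) has_sum (f x * b)) UNIV" for x
    by (intro has_sum_cmult_right g)
  moreover have "((\<lambda>x. f x * b) has_sum (a * b)) UNIV"
    by (intro has_sum_cmult_left f)
  ultimately have "((\<lambda>(x, y). f x * g y) has_sum (a * b)) (UNIV \<times> UNIV)"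
    by (intro has_sum_SigmaI) auto
  thus ?thesis by simp
qed

text \<open>Both thetas on the left are series of nome \<open>sqrt p\<close>. Their product involves
  \<open>x\<close> only through \<open>m + n\<close> and \<open>y\<close> only through
  \<open>m - n\<close>, so rotating the index lattice separates the variables into series of nome
  \<open>p\<close>.\<close>

lemma qtheta_product:
  assumes p: "0 < p" "p < 1" and x: "x \<noteq> 0" and y: "y \<noteq> 0"
  defines "T \<equiv> \<lambda>z. \<Sum>\<^sub>\<infinity>n. theta_term p z n"
  shows "qtheta p (x * y) * qtheta p (x / y) * (qpoch p p)\<^sup>2 =
           T (x\<^sup>2 / p) * T (y\<^sup>2) - x / y * (T (x\<^sup>2) * T (y\<^sup>2 / p))"
proof -
  define r where "r = sqrt p"
  have r: "0 < r" "r < 1" "r\<^sup>2 = p" using p by (auto simp: r_def)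
  have T: "(theta_term p z has_sum T z) UNIV" if "z \<noteq> 0" for z
    unfolding T_def
    by (rule has_sum_infsum[OF abs_summable_summable[OF abs_summable_on_theta_term[OF p that]]])
  have J: "(theta_term r (- w / r) has_sum (qtheta p w * qpoch p p)) UNIV" if "w \<noteq> 0" for w
  proof -
    \<comment> \<open>The argument \<open>- w / r\<close> is chosen so that the triple product has
      the factors \<open>qpoch w p\<close> and \<open>qpoch (p / w) p\<close>.\<close>
    have "- (- w / r) * r = w" "- r / (- w / r) = p / w"
      using r that by (auto simp: field_simps power2_eq_square)
    with jacobi_triple_product[OF r(1,2), of "- w / r"] r that show ?thesis
      by (simp add: qtheta_def)
  qed
  have prod: "((\<lambda>(m, n). theta_term s z m * theta_term s w n) has_sum (a * b)) UNIV"
    if "0 < s" "s < 1" "z \<noteq> 0" "w \<noteq> 0"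
      "(theta_term s z has_sum a) UNIV" "(theta_term s w has_sum b) UNIV" for s z w a b
    using that by (intro has_sum_product abs_summable_on_theta_term)
  \<comment> \<open>In the product of the two theta series, the index pairs with \<open>m + n\<close> even, respectively odd, are those of the
    two products on the right.\<close>
  define F where "F = (\<lambda>(m, n). theta_term r (- (x * y) / r) m * theta_term r (- (x / y) / r) n)"
  define G where "G = (\<lambda>(a, b). theta_term p (x\<^sup>2 / p) a * theta_term p (y\<^sup>2) b)"
  define H where "H = (\<lambda>(a, b). theta_term p (x\<^sup>2) a * theta_term p (y\<^sup>2 / p) b)"
  have F_eq: "F (m, n) = (-1) powi (m + n) * r powi (m * m - m + (n * n - n)) * x powi (m + n) * y powi (m - n)"
    for m n
  proof -
    have *: "theta_term r (- w / r) k = (-1) powi k * r powi (k * k - k) * w powi k" for w k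
    proof -
      have "theta_term r (- w / r) k = r powi (k * k) * ((-1) * w * inverse r) powi k"
        by (simp add: theta_term_def field_simps)
      also have "\<dots> = r powi (k * k) * ((-1) powi k * w powi k * r powi (- k))"
        by (simp only: power_int_mult_distrib power_int_inverse power_int_minus)
      also have "\<dots> = (-1) powi k * (r powi (k * k) * r powi (- k)) * w powi k"
        by (simp only: mult_ac)
      also have "r powi (k * k) * r powi (- k) = r powi (k * k - k)"
        using r by (simp flip: power_int_add)
      finally show ?thesis .
    qed
    have xy: "(x * y) powi m * (x / y) powi n = x powi (m + n) * y powi (m - n)"
      using x y by (simp add: power_int_add power_int_diff power_int_mult_distrib power_int_divide_distrib)
    have "F (m, n) = ((-1) powi m * (-1) powi n) * (r powi (m * m - m) * r powi (n * n - n)) *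
        ((x * y) powi m * (x / y) powi n)"
      unfolding F_def prod.case * by (simp only: mult_ac)
    also have "\<dots> = (-1) powi (m + n) * r powi (m * m - m + (n * n - n)) * (x powi (m + n) * y powi (m - n))"
      unfolding xy using r by (simp add: power_int_add)
    finally show ?thesis by (simp only: mult.assoc)
  qed
  have p_eq: "p powi k = r powi (2 * k)" for k
    unfolding r(3)[symmetric] by (simp add: power_int_mult)
  have sq: "w\<^sup>2 powi k = w powi (2 * k)" for w :: real and k
    by (simp add: power_int_mult)
  have T1: "theta_term p (w\<^sup>2 / p) k = r powi (2 * (k * k - k)) * w powi (2 * k)" for w k
  proof -
    have "theta_term p (w\<^sup>2 / p) k = p powi (k * k) * p powi (- k) * w\<^sup>2 powi k"
      by (simp add: theta_term_def power_int_divide_distrib power_int_minus field_simps)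
    also have "p powi (k * k) * p powi (- k) = p powi (k * k - k)"
      using p by (simp flip: power_int_add)
    finally show ?thesis unfolding p_eq sq .
  qed
  have T2: "theta_term p (w\<^sup>2) k = r powi (2 * (k * k)) * w powi (2 * k)" for w k
    unfolding theta_term_def p_eq sq ..
  have r_add: "r powi (i + j) = r powi i * r powi j" for i j
    using r by (simp add: power_int_add)
  have even: "F (a + b, a - b) = G (a, b)" for a b
  proof -
    have e: "(a + b) * (a + b) - (a + b) + ((a - b) * (a - b) - (a - b)) = 2 * (a * a - a) + 2 * (b * b)"
      "a + b + (a - b) = 2 * a" "a + b - (a - b) = 2 * b"
      by (simp_all add: algebra_simps)
    show ?thesis
      unfolding F_eq G_def prod.case T1 T2 e unfolding r_add by simp
  qed
  have odd: "F (a + b, a - b + 1) = - (x / y) * H (a, b)" for a b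
  proof -
    have e: "(a + b) * (a + b) - (a + b) + ((a - b + 1) * (a - b + 1) - (a - b + 1)) =
        2 * (a * a) + 2 * (b * b - b)"
      "a + b + (a - b + 1) = 2 * a + 1" "a + b - (a - b + 1) = 2 * b - 1"
      by (simp_all add: algebra_simps)
    have xy: "x powi (2 * a + 1) = x powi (2 * a) * x" "y powi (2 * b - 1) = y powi (2 * b) / y"
      using x y by (simp_all add: power_int_add power_int_diff)
    have m1: "(-1) powi (2 * a + 1) = (-1 :: real)"
      by (simp add: power_int_add)
    show ?thesis
      unfolding F_eq H_def prod.case T1 T2 e unfolding xy m1 r_add by simp
  qed
  have "(G has_sum (T (x\<^sup>2 / p) * T (y\<^sup>2))) UNIV"
    unfolding G_def using p x y by (intro prod T) auto
  hence S1: "(F has_sum (T (x\<^sup>2 / p) * T (y\<^sup>2))) {(m, n). even (m + n)}"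
    by (subst (asm) has_sum_reindex_bij_witness[where T = "{(m, n). even (m + n)}" and h = F
          and j = "\<lambda>(a, b). (a + b, a - b)" and i = "\<lambda>(m, n). ((m + n) div 2, (m - n) div 2)"])
      (auto simp: even, presburger+)
  have "((\<lambda>z. - (x / y) * H z) has_sum (- (x / y) * (T (x\<^sup>2) * T (y\<^sup>2 / p)))) UNIV"
    unfolding H_def using p x y by (intro has_sum_cmult_right prod T) auto
  hence S2: "(F has_sum (- (x / y) * (T (x\<^sup>2) * T (y\<^sup>2 / p)))) {(m, n). odd (m + n)}"
    by (subst (asm) has_sum_reindex_bij_witness[where T = "{(m, n). odd (m + n)}" and h = F
          and j = "\<lambda>(a, b). (a + b, a - b + 1)" and i = "\<lambda>(m, n). ((m + n - 1) div 2, (m - n + 1) div 2)"])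
      (auto simp: odd, presburger+)
  have "(F has_sum (T (x\<^sup>2 / p) * T (y\<^sup>2) + - (x / y) * (T (x\<^sup>2) * T (y\<^sup>2 / p))))
          ({(m, n). even (m + n)} \<union> {(m, n). odd (m + n)})"
    using S1 S2 by (rule has_sum_Un_disjoint) auto
  also have "{(m, n). even (m + n)} \<union> {(m, n). odd (m + n)} = (UNIV :: (int \<times> int) set)"
    by auto
  finally have "(F has_sum (T (x\<^sup>2 / p) * T (y\<^sup>2) + - (x / y) * (T (x\<^sup>2) * T (y\<^sup>2 / p)))) UNIV" .
  moreover have "(F has_sum ((qtheta p (x * y) * qpoch p p) * (qtheta p (x / y) * qpoch p p))) UNIV"
    unfolding F_def using r x y by (intro prod J) auto
  ultimately show ?thesis
    using has_sum_unique by (fastforce simp: power2_eq_square mult_ac)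
qed

text \<open>Up to the constant \<open>(qpoch p p)\<^sup>2\<close>, the six values of
  \<open>D\<close> are the 2 x 2 minors of the 2 x 4 matrix whose columns are the values of
  \<open>U\<close> and \<open>V\<close> at the four points; the claim is the Pluecker relation
  between them.\<close>

theorem weierstrass_three_term:
  assumes p: "0 < p" "p < 1" and nz: "x \<noteq> 0" "y \<noteq> 0" "z \<noteq> 0" "w \<noteq> 0"
  defines "D \<equiv> \<lambda>x y. qtheta p (x * y) * qtheta p (x / y) / x"
  shows "D x y * D z w - D x z * D y w + D x w * D y z = 0"
proof -
  define T where "T = (\<lambda>z. \<Sum>\<^sub>\<infinity>n. theta_term p z n)"
  define U V where "U = (\<lambda>x. T (x\<^sup>2 / p) / x)" and "V = (\<lambda>x. T (x\<^sup>2))"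
  have D: "D x y * (qpoch p p)\<^sup>2 = U x * V y - V x * U y" if "x \<noteq> 0" "y \<noteq> 0" for x y
    using qtheta_product[OF p that] that unfolding D_def U_def V_def T_def
    by (simp add: field_simps)
  have "(D x y * D z w - D x z * D y w + D x w * D y z) * ((qpoch p p)\<^sup>2 * (qpoch p p)\<^sup>2) =
     (D x y * (qpoch p p)\<^sup>2) * (D z w * (qpoch p p)\<^sup>2) - (D x z * (qpoch p p)\<^sup>2) * (D y w * (qpoch p p)\<^sup>2) +
     (D x w * (qpoch p p)\<^sup>2) * (D y z * (qpoch p p)\<^sup>2)"
    by algebra
  also have "\<dots> = 0"
    unfolding D[OF nz(1,2)] D[OF nz(3,4)] D[OF nz(1,3)] D[OF nz(2,4)] D[OF nz(1,4)] D[OF nz(2,3)]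
    by algebra
  finally show ?thesis using qpoch_self_pos[OF p] by simp
qed


section \<open>Eta quotients of level 6, 10 and 30\<close>

text \<open>The ordering of the exponents keeps all differences natural. Clearing the prefactors
  \<open>1 / x\<close> leaves only the power \<open>q ^ (j - k)\<close>.\<close>

lemma weierstrass_three_term_powers:
  fixes q :: real
  assumes q: "0 < q" "q < 1" and "m > 0" and le: "l \<le> k" "k \<le> j" "j \<le> i"
  defines "th \<equiv> \<lambda>n. qtheta (q ^ m) (q ^ n)"
  shows "q ^ (j - k) * (th (i + j) * th (i - j) * th (k + l) * th (k - l)) +
           th (i + l) * th (i - l) * th (j + k) * th (j - k) =
           th (i + k) * th (i - k) * th (j + l) * th (j - l)"
proof -
  have p: "0 < q ^ m" "q ^ m < 1" using q \<open>m > 0\<close> by (auto simp: power_less_one_iff)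
  have D: "qtheta (q ^ m) (q ^ a * q ^ b) * qtheta (q ^ m) (q ^ a / q ^ b) / q ^ a =
             th (a + b) * th (a - b) / q ^ a" if "b \<le> a" for a b
    using that q by (simp add: th_def power_add power_diff)
  have "th (i + j) * th (i - j) / q ^ i * (th (k + l) * th (k - l) / q ^ k) -
        th (i + k) * th (i - k) / q ^ i * (th (j + l) * th (j - l) / q ^ j) +
        th (i + l) * th (i - l) / q ^ i * (th (j + k) * th (j - k) / q ^ j) = 0"
    using weierstrass_three_term[OF p, of "q ^ i" "q ^ j" "q ^ k" "q ^ l"] q le
    by (simp only: D order_trans[of l k j] order_trans[of k j i] order_trans[of l k i] le
          order_trans[of l j i] power_eq_0_iff simp_thms) simp
  moreover have "q ^ j = q ^ k * q ^ (j - k)"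
    using le by (simp flip: power_add)
  ultimately show ?thesis
    using q by (simp add: divide_simps) (simp add: algebra_simps)
qed

text \<open>Serves to write all eta factors of a given level in the common base
  \<open>q ^ m\<close>, where identities between them become cancellations.\<close>

lemma qpoch_power_multisection:
  assumes "0 < q" "q < 1" "d > 0" "k > 0" "m = d * k"
  shows "qpoch (q ^ d) (q ^ d) = (\<Prod>j<k. qpoch (q ^ (d * Suc j)) (q ^ m))"
proof -
  have "\<bar>q ^ d\<bar> < 1" using assms by (simp add: power_less_one_iff)
  from qpoch_multisection[OF this \<open>k > 0\<close>, of "q ^ d"] show ?thesis
    by (simp add: \<open>m = _\<close> power_add flip: power_mult)
qed

context
  fixes q :: real
  assumes q: "0 < q" "q < 1"
begin

lemma qpoch_powers_pos: "n > 0 \<Longrightarrow> m > 0 \<Longrightarrow> qpoch (q ^ n) (q ^ m) > 0"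
  using q by (intro qpoch_pos) (auto simp: power_less_one_iff)

lemma qtheta_powers:
  "n \<le> m \<Longrightarrow> qtheta (q ^ m) (q ^ n) = qpoch (q ^ n) (q ^ m) * qpoch (q ^ (m - n)) (q ^ m)"
  using q by (simp add: qtheta_def power_diff)

lemma level_6_identity:
  defines "e \<equiv> \<lambda>d. qpoch (q ^ d) (q ^ d)"
  shows "1 + q * e 1 ^ 3 * e 6 ^ 9 / (e 2 ^ 3 * e 3 ^ 9) = e 2 ^ 5 * e 6 / (e 1 * e 3 ^ 5)"
proof -
  define P Th where "P = (\<lambda>n. qpoch (q ^ n) (q ^ 6))" and "Th = (\<lambda>n. qtheta (q ^ 6) (q ^ n))"
  have nz: "P n \<noteq> 0" if "n > 0" for n
    using that qpoch_powers_pos[of n 6] by (simp add: P_def)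
  have e: "e 1 = P 1 * P 2 * P 3 * P 4 * P 5 * P 6" "e 2 = P 2 * P 4 * P 6"
    "e 3 = P 3 * P 6" "e 6 = P 6"
    using qpoch_power_multisection[OF q, of 1 6 6] qpoch_power_multisection[OF q, of 2 3 6]
      qpoch_power_multisection[OF q, of 3 2 6]
    by (simp_all add: e_def P_def numeral_eq_Suc)
  have "Th 1 = P 1 * P 5" "Th 2 = P 2 * P 4" "Th 3 = P 3 * P 3" "Th 4 = P 2 * P 4" "Th 5 = P 1 * P 5"
    unfolding Th_def P_def by (subst qtheta_powers; simp)+
  \<comment> \<open>The choice (i, j, k, l) = (3, 2, 1, 0). The reflection of \<open>n\<close> to
    \<open>6 - n\<close> merges the factors, and dividing by the middle term gives the
    claim.\<close>
  moreover have "q * (Th 5 * Th 1 * Th 1 * Th 1) + Th 3 * Th 3 * Th 3 * Th 1 = Th 4 * Th 2 * Th 2 * Th 2"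
    using weierstrass_three_term_powers[OF q, of 6 0 1 2 3] by (simp add: Th_def)
  ultimately have "q * (P 1 * P 5) ^ 4 + P 3 ^ 6 * (P 1 * P 5) = (P 2 * P 4) ^ 4"
    by algebra
  thus ?thesis
    unfolding e by (simp add: divide_simps nz) algebra
qed

lemma level_10_identity:
  defines "e \<equiv> \<lambda>d. qpoch (q ^ d) (q ^ d)"
  shows "1 - q * e 10 ^ 4 * e 1 ^ 2 / (e 5 ^ 2 * e 2 ^ 4) = e 1 * e 5 ^ 3 / (e 2 ^ 3 * e 10)"
proof -
  define P Th where "P = (\<lambda>n. qpoch (q ^ n) (q ^ 10))" and "Th = (\<lambda>n. qtheta (q ^ 10) (q ^ n))"
  have nz: "P n \<noteq> 0" if "n > 0" for n
    using that qpoch_powers_pos[of n 10] by (simp add: P_def)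
  have e: "e 1 = P 1 * P 2 * P 3 * P 4 * P 5 * P 6 * P 7 * P 8 * P 9 * P 10"
    "e 2 = P 2 * P 4 * P 6 * P 8 * P 10" "e 5 = P 5 * P 10" "e 10 = P 10"
    using qpoch_power_multisection[OF q, of 1 10 10] qpoch_power_multisection[OF q, of 2 5 10]
      qpoch_power_multisection[OF q, of 5 2 10]
    by (simp_all add: e_def P_def numeral_eq_Suc)
  have "Th 1 = P 1 * P 9" "Th 2 = P 2 * P 8" "Th 3 = P 3 * P 7" "Th 4 = P 4 * P 6"
    "Th 5 = P 5 * P 5" "Th 6 = P 4 * P 6" "Th 7 = P 3 * P 7"
    unfolding Th_def P_def by (subst qtheta_powers; simp)+
  \<comment> \<open>The choice (i, j, k, l) = (4, 3, 2, 1); after reflection only the products over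
    the residues 1, 3 and over 2, 4 remain, besides \<open>Th 5\<close>.\<close>
  moreover have "q * (Th 7 * Th 1 * Th 3 * Th 1) + Th 5 * Th 3 * Th 5 * Th 1 = Th 6 * Th 2 * Th 4 * Th 2"
    using weierstrass_three_term_powers[OF q, of 10 1 2 3 4] by (simp add: Th_def)
  ultimately have "q * (P 1 * P 9 * P 3 * P 7) ^ 2 + P 5 ^ 4 * (P 1 * P 9 * P 3 * P 7) =
      (P 2 * P 8 * P 4 * P 6) ^ 2"
    by algebra
  thus ?thesis
    unfolding e by (simp add: divide_simps nz) algebra
qed

lemma level_30_identity:
  defines "e \<equiv> \<lambda>d. qpoch (q ^ d) (q ^ d)"
  shows "1 + q * e 2 ^ 2 * e 30 ^ 2 * e 3 * e 5 / (e 1 * e 15 * e 6 ^ 2 * e 10 ^ 2) =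
           e 2 * e 3 ^ 2 * e 5 ^ 2 * e 30 / (e 1 * e 15 * e 6 ^ 2 * e 10 ^ 2)"
proof -
  define P Th where "P = (\<lambda>n. qpoch (q ^ n) (q ^ 30))" and "Th = (\<lambda>n. qtheta (q ^ 30) (q ^ n))"
  have nz: "P n \<noteq> 0" if "n > 0" for n
    using that qpoch_powers_pos[of n 30] by (simp add: P_def)
  have Th: "Th 1 = P 1 * P 29" "Th 2 = P 2 * P 28" "Th 3 = P 3 * P 27" "Th 4 = P 4 * P 26"
    "Th 5 = P 5 * P 25" "Th 6 = P 6 * P 24" "Th 7 = P 7 * P 23" "Th 8 = P 8 * P 22"
    "Th 9 = P 9 * P 21" "Th 10 = P 10 * P 20" "Th 11 = P 11 * P 19" "Th 12 = P 12 * P 18"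
    "Th 13 = P 13 * P 17" "Th 14 = P 14 * P 16" "Th 15 = P 15 * P 15" "Th 16 = P 14 * P 16"
    unfolding Th_def P_def by (subst qtheta_powers; simp)+
  have nzT: "Th n \<noteq> 0" if "n > 0" "n < 30" for n
    using that nz[of n] nz[of "30 - n"] by (simp add: Th_def P_def qtheta_powers)
  have e: "e 1 = Th 1 * Th 2 * Th 3 * Th 4 * Th 5 * Th 6 * Th 7 * Th 8 * Th 9 * Th 10 *
      Th 11 * Th 12 * Th 13 * Th 14 * P 15 * P 30"
    "e 2 = Th 2 * Th 4 * Th 6 * Th 8 * Th 10 * Th 12 * Th 14 * P 30"
    "e 3 = Th 3 * Th 6 * Th 9 * Th 12 * P 15 * P 30"
    "e 5 = Th 5 * Th 10 * P 15 * P 30"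
    "e 6 = Th 6 * Th 12 * P 30" "e 10 = Th 10 * P 30" "e 15 = P 15 * P 30" "e 30 = P 30"
    unfolding Th
    using qpoch_power_multisection[OF q, of 1 30 30] qpoch_power_multisection[OF q, of 2 15 30]
      qpoch_power_multisection[OF q, of 3 10 30] qpoch_power_multisection[OF q, of 5 6 30]
      qpoch_power_multisection[OF q, of 6 5 30] qpoch_power_multisection[OF q, of 10 3 30]
      qpoch_power_multisection[OF q, of 15 2 30]
    by (simp_all add: e_def P_def numeral_eq_Suc mult_ac)
  \<comment> \<open>The choice (i, j, k, l) = (9, 7, 6, 2), with \<open>Th 16 = Th 14\<close>. The
    second product runs over the residues prime to 30 up to sign, and dividing by it produces
    \<open>1 + t\<close>.\<close>
  have W: "q * (Th 14 * Th 2 * Th 8 * Th 4) + Th 11 * Th 7 * Th 13 * Th 1 = Th 15 * Th 3 * Th 9 * Th 5"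
    using weierstrass_three_term_powers[OF q, of 30 2 6 7 9] Th(14,16) by (simp add: Th_def)
  have "q * e 2 ^ 2 * e 30 ^ 2 * e 3 * e 5 / (e 1 * e 15 * e 6 ^ 2 * e 10 ^ 2) =
      q * (Th 14 * Th 2 * Th 8 * Th 4) / (Th 11 * Th 7 * Th 13 * Th 1)"
    unfolding e by (simp add: divide_simps nz nzT) (simp add: power2_eq_square mult_ac)
  moreover have "e 2 * e 3 ^ 2 * e 5 ^ 2 * e 30 / (e 1 * e 15 * e 6 ^ 2 * e 10 ^ 2) =
      P 15 * P 15 * Th 3 * Th 9 * Th 5 / (Th 11 * Th 7 * Th 13 * Th 1)"
    unfolding e by (simp add: divide_simps nz nzT) (simp add: power2_eq_square mult_ac)
  moreover have "1 + q * (Th 14 * Th 2 * Th 8 * Th 4) / (Th 11 * Th 7 * Th 13 * Th 1) =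
      P 15 * P 15 * Th 3 * Th 9 * Th 5 / (Th 11 * Th 7 * Th 13 * Th 1)"
    using W nzT by (simp add: divide_simps Th(15))
  ultimately show ?thesis by simp
qed

end

section \<open>The modular equation\<close>

text \<open>Here \<open>s\<close>, \<open>x\<close>, \<open>y\<close> stand for u v, u^3, v^3, and
  \<open>xy\<close> for the eta quotient expression of (1 + v^3) / (1 + u^3). The conclusion is the
  equation of the curve in \<open>t\<close> and \<open>c\<close>.\<close>

lemma level_30_quadratic:
  fixes t c :: real
  assumes pos: "t > 0" "c > 0" and nz: "1 - c \<noteq> 0" "1 - t^2 * c \<noteq> 0"
  defines "s \<equiv> t^2 * (1 - c) / ((1 - t^2 * c) * (1 + t)^2)"
  defines "x \<equiv> s * (1 - c) / (c * (1 + t)^3)" and "y \<equiv> s * t^2 * c * (1 + t) / (1 - t^2 * c)"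
  assumes xy: "1 + y = (1 + t)^4 * c^2 / (t^2 * (1 - c) * (1 - t^2 * c)) * (1 + x)"
  shows "5 * t^3 * c^2 - c * (1 + 3 * t + 3 * t^3 - t^4) + t = 0"
proof -
  \<comment> \<open>Cleared of denominators, the hypothesis is a cubic in \<open>c\<close>; besides the asserted quadratic it has the
    linear factor \<open>t + c * (1 + t + t\<^sup>2)\<close>, which is positive.\<close>
  define K L p where "K = 1 - c" and "L = 1 - t^2 * c" and "p = 1 + t"
  have nz: "K \<noteq> 0" "L \<noteq> 0" "p \<noteq> 0" "t \<noteq> 0" "c \<noteq> 0"
    using pos nz by (auto simp: K_def L_def p_def)
  have y: "1 + y = (p * L^2 + t^4 * c * K) / (p * L^2)"
    unfolding y_def s_def K_def[symmetric] L_def[symmetric] p_def[symmetric]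
    using nz by (simp add: divide_simps) algebra
  have x: "1 + x = (p^5 * c * L + t^2 * K^2) / (p^5 * c * L)"
    unfolding x_def s_def K_def[symmetric] L_def[symmetric] p_def[symmetric]
    using nz by (simp add: divide_simps) algebra
  have "(1 + y) * (p * L^2 * t^2 * K) = t^2 * K * (p * L^2 + t^4 * c * K)"
    unfolding y using nz by simp
  moreover have "(1 + y) * (p * L^2 * t^2 * K) = c * (p^5 * c * L + t^2 * K^2)"
    unfolding xy x K_def[symmetric] L_def[symmetric] p_def[symmetric]
    using nz by (simp add: divide_simps) algebra
  ultimately have "t^2 * K * (p * L^2 + t^4 * c * K) = c * (p^5 * c * L + t^2 * K^2)" by simp
  hence "p * ((5 * t^3 * c^2 - c * (1 + 3 * t + 3 * t^3 - t^4) + t) * (t + c * (1 + t + t^2))) = 0"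
    unfolding K_def L_def p_def by algebra
  moreover have "t + c * (1 + t + t^2) > 0"
    using pos by (intro add_pos_pos mult_pos_pos) auto
  ultimately show ?thesis using nz by simp
qed

text \<open>The conclusion is the modular equation in s = u v and x + y = u^3 + v^3. Its left side,
  as a rational function of \<open>t\<close> and \<open>c\<close>, has the polynomial of
  \<open>quad\<close> as a factor of its numerator.\<close>

lemma quintic_relation_parametrized:
  fixes t c :: real
  assumes nz: "1 + t \<noteq> 0" "c \<noteq> 0" "1 - t^2 * c \<noteq> 0"
    and quad: "5 * t^3 * c^2 - c * (1 + 3 * t + 3 * t^3 - t^4) + t = 0"
  defines "s \<equiv> t^2 * (1 - c) / ((1 - t^2 * c) * (1 + t)^2)"
  defines "x \<equiv> s * (1 - c) / (c * (1 + t)^3)" and "y \<equiv> s * t^2 * c * (1 + t) / (1 - t^2 * c)"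
  shows "(x + y)^2 + 5 * (x + y) * s * (1 - 2 * s) - s + 5 * s^2 - 22 * s^3 + 20 * s^4 - 16 * s^5 = 0"
proof -
  define K L p where "K = 1 - c" and "L = 1 - t^2 * c" and "p = 1 + t"
  define n where "n = K * L + t^2 * c^2 * p^4"
  define m where "m = t^2 * K"
  have nz: "L \<noteq> 0" "p \<noteq> 0" "c \<noteq> 0"
    using nz by (auto simp: L_def p_def)
  have s: "s = m / (L * p^2)"
    by (simp add: s_def m_def K_def L_def p_def)
  have xy: "x + y = s * (n / (c * p^3 * L))"
    unfolding x_def y_def n_def K_def[symmetric] L_def[symmetric] p_def[symmetric]
    using nz by (simp add: divide_simps) algebra
  have "(x + y)^2 + 5 * (x + y) * s * (1 - 2 * s) - s + 5 * s^2 - 22 * s^3 + 20 * s^4 - 16 * s^5 =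
      s * (m * n^2 * L + 5 * m * n * c * p^3 * L^2 - 10 * m^2 * n * c * p * L - L^4 * p^8 * c^2
        + 5 * m * L^3 * p^6 * c^2 - 22 * m^2 * L^2 * p^4 * c^2 + 20 * m^3 * L * p^2 * c^2
        - 16 * m^4 * c^2) / (L^4 * p^8 * c^2)"
    unfolding xy s using nz by (simp add: divide_simps) algebra
  \<comment> \<open>The long factor is the quotient of the numerator by the polynomial of
    \<open>quad\<close>.\<close>
  also have "m * n^2 * L + 5 * m * n * c * p^3 * L^2 - 10 * m^2 * n * c * p * L - L^4 * p^8 * c^2
        + 5 * m * L^3 * p^6 * c^2 - 22 * m^2 * L^2 * p^4 * c^2 + 20 * m^3 * L * p^2 * c^2
        - 16 * m^4 * c^2 =
      (5 * t^3 * c^2 - c * (1 + 3 * t + 3 * t^3 - t^4) + t) *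
      (t + c + 5 * t * c + 15 * t^2 * c + 5 * t^3 * c - 6 * t^4 * c - 3 * t^2 * c^2 - 3 *
        t^3 * c^2 - 39 * t^4 * c^2 - 75 * t^5 * c^2 - 36 * t^6 * c^2 - 6 * t^7 * c^2 + 18 *
        t^4 * c^3 + 39 * t^5 * c^3 + 36 * t^6 * c^3 + 51 * t^7 * c^3 + 39 * t^8 * c^3 + 12 *
        t^9 * c^3 + t^10 * c^3 - 9 * t^7 * c^4 - 12 * t^8 * c^4 - 14 * t^9 * c^4 - 13 * t^10
        * c^4 - 6 * t^11 * c^4 - t^12 * c^4)"
    unfolding m_def n_def K_def L_def p_def by algebra
  finally show ?thesis using quad by simp
qed

text \<open>In base q^6, e_1 / e_2 leaves the odd residues 1, 3, 5 and (e_6 / e_3)^3 leaves the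
  inverse cube of residue 3, so the quotient is \<open>P 1 * P 5 / P 3 ^ 2\<close>.\<close>

lemma cubic_cf_eq_qpoch:
  assumes q: "0 < q" "q < 1"
  defines "e \<equiv> \<lambda>d. qpoch (q ^ d) (q ^ d)"
  shows "cubic_cf q = q powr (1/3) * (e 1 * e 6 ^ 3 / (e 2 * e 3 ^ 3))"
proof -
  define P where "P = (\<lambda>n. qpoch (q ^ n) (q ^ 6))"
  have nz: "P n \<noteq> 0" if "n > 0" for n
    using that qpoch_powers_pos[OF q, of n 6] by (simp add: P_def)
  have e: "e 1 = P 1 * P 2 * P 3 * P 4 * P 5 * P 6" "e 2 = P 2 * P 4 * P 6"
    "e 3 = P 3 * P 6" "e 6 = P 6"
    using qpoch_power_multisection[OF q, of 1 6 6] qpoch_power_multisection[OF q, of 2 3 6]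
      qpoch_power_multisection[OF q, of 3 2 6]
    by (simp_all add: e_def P_def numeral_eq_Suc)
  have "\<bar>q ^ 6\<bar> < 1" using q by (simp add: power_less_one_iff)
  hence conv: "convergent_prod (\<lambda>n. 1 - q ^ (6 * n + k))" for k
    using convergent_prod_qpoch[of "q ^ 6" "q ^ k"] by (simp add: power_add mult_ac flip: power_mult)
  have P: "P k = (\<Prod>n. 1 - q ^ (6 * n + k))" for k
    by (simp add: P_def qpoch_def power_add mult_ac flip: power_mult)
  have "(\<Prod>n. (1 - q ^ (6*n+1)) * (1 - q ^ (6*n+5)) / (1 - q ^ (6*n+3))\<^sup>2) = P 1 * P 5 / P 3 ^ 2"
    unfolding P
    by (simp only: prodinf_mult prodinf_power [symmetric] prodinf_divide conv convergent_prod_mult convergent_prod_power)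
  also have "\<dots> = e 1 * e 6 ^ 3 / (e 2 * e 3 ^ 3)"
    unfolding e by (simp add: divide_simps nz) algebra
  finally show ?thesis unfolding cubic_cf_def by (simp only:)
qed

theorem mainTheorem4:
  fixes q u v :: real
  assumes "0 < q" and "q < 1"
    and "u = cubic_cf q" and "v = cubic_cf (q ^ 5)"
  shows "u^6 - u * v + 5 * u^4 * v + 5 * u^2 * v^2 - 10 * u^5 * v^2 - 20 * u^3 * v^3 + 5 * u * v^4
           + 20 * u^4 * v^4 - 10 * u^2 * v^5 - 16 * u^5 * v^5 + v^6 = 0"
proof -
  note q = assms(1,2)
  define e where "e = (\<lambda>d. qpoch (q ^ d) (q ^ d))"
  have e_pos: "e d > 0" if "d > 0" for d
    using qpoch_powers_pos[OF q that that] by (simp add: e_def)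
  have nz: "e d \<noteq> 0" if "d > 0" for d using e_pos[OF that] by simp
  have q_power: "0 < q ^ d" "q ^ d < 1" if "d > 0" for d
    using q that by (auto simp: power_less_one_iff)

  define t where "t = q * e 2 ^ 2 * e 30 ^ 2 * e 3 * e 5 / (e 1 * e 15 * e 6 ^ 2 * e 10 ^ 2)"
  define c where "c = q * e 10 ^ 4 * e 1 ^ 2 / (e 5 ^ 2 * e 2 ^ 4)"
  \<comment> \<open>\<open>x\<close>, \<open>y\<close>, \<open>s\<close> are the eta quotients of
    u^3, v^3 and u v, in which no fractional power of \<open>q\<close> is left.\<close>
  define x where "x = q * e 1 ^ 3 * e 6 ^ 9 / (e 2 ^ 3 * e 3 ^ 9)"
  define y where "y = q ^ 5 * e 5 ^ 3 * e 30 ^ 9 / (e 10 ^ 3 * e 15 ^ 9)"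
  define s where "s = q ^ 2 * (e 1 * e 6 ^ 3 / (e 2 * e 3 ^ 3)) * (e 5 * e 30 ^ 3 / (e 10 * e 15 ^ 3))"
  have pos: "t > 0" "c > 0" unfolding t_def c_def
    by (intro divide_pos_pos mult_pos_pos zero_less_power e_pos q; simp)+
  have t1: "1 + t = e 2 * e 3 ^ 2 * e 5 ^ 2 * e 30 / (e 1 * e 15 * e 6 ^ 2 * e 10 ^ 2)"
    using level_30_identity[OF q] unfolding t_def e_def .
  have c1: "1 - c = e 1 * e 5 ^ 3 / (e 2 ^ 3 * e 10)"
    using level_10_identity[OF q] unfolding c_def e_def .
  \<comment> \<open>The right side is \<open>c\<close> with \<open>q\<close> replaced by
    \<open>q ^ 3\<close>, so the level 10 identity at \<open>q ^ 3\<close> factors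
    \<open>1 - t ^ 2 * c\<close>.\<close>
  have "t ^ 2 * c = q ^ 3 * e 30 ^ 4 * e 3 ^ 2 / (e 15 ^ 2 * e 6 ^ 4)"
    using q unfolding t_def c_def by (simp add: divide_simps nz) algebra
  hence tc1: "1 - t ^ 2 * c = e 3 * e 15 ^ 3 / (e 6 ^ 3 * e 30)"
    using level_10_identity[OF q_power, of 3] by (simp add: e_def)
  have x1: "1 + x = e 2 ^ 5 * e 6 / (e 1 * e 3 ^ 5)"
    using level_6_identity[OF q] unfolding x_def e_def .
  have y1: "1 + y = e 10 ^ 5 * e 30 / (e 5 * e 15 ^ 5)"
    using level_6_identity[OF q_power, of 5] by (simp add: e_def y_def)

  \<comment> \<open>Once \<open>1 + t\<close>, \<open>1 - c\<close> and \<open>1 - t ^ 2 * c\<close>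
    are eta quotients, these four relations only compare exponents of \<open>q\<close> and of the
    \<open>e d\<close>.\<close>
  have s: "s = t ^ 2 * (1 - c) / ((1 - t ^ 2 * c) * (1 + t) ^ 2)"
    unfolding tc1 c1 t1 unfolding s_def t_def using q by (simp add: divide_simps nz) algebra
  have x: "x = s * (1 - c) / (c * (1 + t) ^ 3)"
    unfolding c1 t1 unfolding s_def x_def c_def using q by (simp add: divide_simps nz) algebra
  have y: "y = s * t ^ 2 * c * (1 + t) / (1 - t ^ 2 * c)"
    unfolding tc1 t1 unfolding s_def y_def c_def t_def using q by (simp add: divide_simps nz) algebra
  have xy: "1 + y = (1 + t) ^ 4 * c ^ 2 / (t ^ 2 * (1 - c) * (1 - t ^ 2 * c)) * (1 + x)"
    unfolding x1 y1 tc1 c1 t1 unfolding c_def t_def using q by (simp add: divide_simps nz) algebra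
  have nz': "1 + t \<noteq> 0" "1 - c \<noteq> 0" "1 - t ^ 2 * c \<noteq> 0"
    unfolding t1 c1 tc1 by (simp_all add: nz)
  have "5 * t^3 * c^2 - c * (1 + 3 * t + 3 * t^3 - t^4) + t = 0"
    using level_30_quadratic[OF pos nz'(2,3)] xy unfolding x y s by simp
  hence rel: "(x + y)^2 + 5 * (x + y) * s * (1 - 2 * s) - s + 5 * s^2 - 22 * s^3 + 20 * s^4 - 16 * s^5 = 0"
    using quintic_relation_parametrized[of t c] nz' pos unfolding x y s by simp

  have u: "u = q powr (1/3) * (e 1 * e 6 ^ 3 / (e 2 * e 3 ^ 3))"
    unfolding assms(3) cubic_cf_eq_qpoch[OF q] e_def ..
  have v: "v = (q ^ 5) powr (1/3) * (e 5 * e 30 ^ 3 / (e 10 * e 15 ^ 3))"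
    unfolding assms(4) using cubic_cf_eq_qpoch[OF q_power, of 5] by (simp add: e_def)
  have cube: "(w powr (1/3)) ^ 3 = w" if "w > 0" for w :: real
    using that by (simp add: powr_powr flip: powr_numeral)
  have q5: "0 < q ^ 5" using q by simp
  have ux: "u ^ 3 = x"
    unfolding u x_def power_mult_distrib cube[OF q(1)] by (simp add: power_divide power_mult_distrib flip: power_mult)
  have vy: "v ^ 3 = y"
    unfolding v y_def power_mult_distrib cube[OF q5]
    by (simp add: power_divide power_mult_distrib flip: power_mult)
  have uv: "u * v = s"
  proof -
    have q2: "q powr (1/3) * (q ^ 5) powr (1/3) = q ^ 2"
      using q by (simp add: powr_powr flip: powr_add powr_numeral)
    show ?thesis unfolding u v s_def q2 [symmetric] by (simp only: mult_ac)
  qed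
  \<comment> \<open>Since u^6 + v^6 = (u^3 + v^3)^2 - 2 (u v)^3, the coefficient -22 of s^3 becomes
    the -20 of the modular equation.\<close>
  from rel [folded ux vy uv] show ?thesis by algebra
qed

end
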